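(* Let $\sigma$ be a finite product (composition) of the Arnoux-Rauzy substitutions $\sigma_1,\sigma_2,\sigma_3$ in which each of the three substitutions appears at least once, and let $\Sigma=\mathbf E_1^*(\sigma)$ be the associated dual substitution. Then, for all $R\geq 0$, there exists $n\geq 0$ such that the ball of radius $R$ centered at the origin (in the contracting plane $\mathcal P_{\mathrm c}$ of $\sigma$) is contained in $\pi_{\mathrm c}(\Sigma^n(\mathcal U))$.
   Context: Let $\mathcal A=\{1,2,3\}$. A substitution is a morphism of the free monoid $\mathcal A^*$ such that the image of each letter is non-empty. The Arnoux-Rauzy substitutions are given, for $i\in\{1,2,3\}$, by $\sigma_i(i)=i$ and $\sigma_i(j)=ji$ for $j\neq i$. The incidence matrix $\mathbf M_\sigma=(m_{ij})$ of a substitution $\sigma$ has $m_{ij}=$ number of occurrences of the letter $i$ in $\sigma(j)$; $\sigma$ is unimodular if $\det \mathbf M_\sigma=\pm1$. Let $(\mathbf e_1,\mathbf e_2,\mathbf e_3)$ be the canonical basis of $\mathbb R^3$. For $\mathbf x\in\mathbb Z^3$ and $i\in\{1,2,3\}$, the unit face $[\mathbf x,i]^*$ is $\{\mathbf x+\lambda\mathbf e_j+\mu\mathbf e_k:\lambda,\mu\in[0,1]\}$ with $\{i,j,k\}=\{1,2,3\}$. Put $\mathcal U=[\mathbf 0,1]^*\cup[\mathbf 0,2]^*\cup[\mathbf 0,3]^*$. For a unimodular substitution $\sigma$, the dual substitution $\mathbf E_1^*(\sigma)$ is $$\mathbf E_1^*(\sigma)([\mathbf x,i]^* )=\mathbf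 M_\sigma^{-1}\mathbf x+\bigcup_{j=1,2,3}\ \bigcup_{s\in\mathcal A^*:\ \sigma(j)=pis}[\mathbf M_\sigma^{-1}\ell(s),j]^*,$$ where the second union is over all suffixes $s$ of $\sigma(j)$ such that $\sigma(j)=pis$ for some $p\in\mathcal A^*$, and $\ell(s)=(|s|_1,|s|_2,|s|_3)$ counts the letters of $s$; it is extended to unions of unit faces by $\mathbf E_1^*(\sigma)(P_1\cup P_2)=\mathbf E_1^*(\sigma)(P_1)\cup\mathbf E_1^*(\sigma)(P_2)$. A product $\sigma$ of $\sigma_1,\sigma_2,\sigma_3$ in which each appears at least once is unimodular and Pisot irreducible: the characteristic polynomial of $\mathbf M_\sigma$ is irreducible and the maximal eigenvalue $\beta$ of $\mathbf M_\sigma$ is a Pisot number. Let $\mathbf u_\beta$ and $\mathbf v_\beta$ be eigenvectors with positive entries, for the eigenvalue $\beta$, of $\mathbf M_\sigma$ and of ${}^{\mathrm t}\mathbf M_\sigma$ respectively. The contracting plane $\mathcal P_{\mathrm c}$ of $\sigma$ is the plane through the origin with normal vector $\mathbf v_\beta$, and $\pi_{\mathrm c}:\mathbb R^3\to\mathcal P_{\mathrm c}$ is the projection onto $\mathcal P_{\mathrm c}$ along $\mathbf u_\beta$. *)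

theory Defs
  imports "HOL-Analysis.Analysis"
begin

text \<open>The alphabet is the three-element type \<open>3\<close>, whose elements are \<open>1\<close>, \<open>2\<close> and \<open>3\<close>
  (with \<open>3 = 0\<close> in this type); it is also the index type of \<open>real ^ 3\<close>. A substitution is
  a map on words, so that products are compositions; its value on the letter \<open>j\<close> is its value on
  the word \<open>[j]\<close>.\<close>

type_synonym word3 = "3 list"

definition morphism_of :: "(3 \<Rightarrow> word3) \<Rightarrow> word3 \<Rightarrow> word3" where
  "morphism_of f w = concat (map f w)"

definition arnoux_rauzy :: "3 \<Rightarrow> word3 \<Rightarrow> word3" where
  "arnoux_rauzy i = morphism_of (\<lambda>j. if j = i then [i] else [j, i])"

text \<open>The product \<open>\<sigma>\<^bsub>i1\<^esub> \<circ> \<dots> \<circ> \<sigma>\<^bsub>ik\<^esub>\<close> for the index list \<open>[i1, \<dots>, ik]\<close>.\<close>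

definition arnoux_rauzy_product :: "3 list \<Rightarrow> word3 \<Rightarrow> word3" where
  "arnoux_rauzy_product ks = foldr (\<lambda>i \<tau>. arnoux_rauzy i \<circ> \<tau>) ks id"

definition abelianization :: "word3 \<Rightarrow> 'a::semiring_1 ^ 3" where
  "abelianization w = (\<chi> i. of_nat (count_list w i))"

definition incidence_matrix :: "(word3 \<Rightarrow> word3) \<Rightarrow> 'a::semiring_1 ^ 3 ^ 3" where
  "incidence_matrix \<sigma> = (\<chi> i j. of_nat (count_list (\<sigma> [j]) i))"

text \<open>The pair \<open>(x, i)\<close> encodes the unit face \<open>[x, i]\<^sup>*\<close>, and a set of pairs encodes the union of
  its faces. No information is lost: distinct unit faces have disjoint relative interiors.\<close>

type_synonym face = "(int ^ 3) \<times> 3"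

definition unit_face :: "face \<Rightarrow> (real ^ 3) set" where
  "unit_face = (\<lambda>(x, i). {(\<chi> r. real_of_int (x $ r)) + a *\<^sub>R axis j 1 + b *\<^sub>R axis k 1 | a b j k.
     a \<in> {0..1} \<and> b \<in> {0..1} \<and> {i, j, k} = UNIV})"

definition realization :: "face set \<Rightarrow> (real ^ 3) set" where
  "realization P = (\<Union>F\<in>P. unit_face F)"

definition lower_faces :: "face set" where
  "lower_faces = {(0, 1), (0, 2), (0, 3)}"

text \<open>The inverse of the incidence matrix is taken over the integers; for unimodular \<open>\<sigma>\<close> it
  exists and agrees with the inverse over the reals.\<close>

definition dual_face :: "(word3 \<Rightarrow> word3) \<Rightarrow> face \<Rightarrow> face set" where
  "dual_face \<sigma> = (\<lambda>(x, i).
     {(matrix_inv (incidence_matrix \<sigma>) *v x + matrix_inv (incidence_matrix \<sigma>) *v abelianization s, j)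
      | j p s. \<sigma> [j] = p @ [i] @ s})"

definition dual_substitution :: "(word3 \<Rightarrow> word3) \<Rightarrow> face set \<Rightarrow> face set" where
  "dual_substitution \<sigma> P = (\<Union>F\<in>P. dual_face \<sigma> F)"

definition is_eigenvalue :: "'a::field ^ 'n ^ 'n \<Rightarrow> 'a \<Rightarrow> bool" where
  "is_eigenvalue A c \<longleftrightarrow> (\<exists>x. x \<noteq> 0 \<and> A *v x = c *s x)"

definition maximal_eigenvalue :: "(word3 \<Rightarrow> word3) \<Rightarrow> real \<Rightarrow> bool" where
  "maximal_eigenvalue \<sigma> \<beta> \<longleftrightarrow> is_eigenvalue (incidence_matrix \<sigma>) \<beta> \<and>
     (\<forall>c::complex. is_eigenvalue (incidence_matrix \<sigma>) c \<longrightarrow> cmod c \<le> \<beta>)"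

definition plane_normal :: "real ^ 3 \<Rightarrow> (real ^ 3) set" where
  "plane_normal v = {x. v \<bullet> x = 0}"

definition proj_along :: "real ^ 3 \<Rightarrow> real ^ 3 \<Rightarrow> real ^ 3 \<Rightarrow> real ^ 3" where
  "proj_along u v x = x - ((v \<bullet> x) / (v \<bullet> u)) *\<^sub>R u"

lemma proj_along_iff:
  assumes "v \<bullet> u \<noteq> 0"
  shows "proj_along u v x = y \<longleftrightarrow> y \<in> plane_normal v \<and> x - y \<in> span {u}"
proof
  assume "proj_along u v x = y"
  then show "y \<in> plane_normal v \<and> x - y \<in> span {u}"
    using assms by (auto simp: proj_along_def plane_normal_def inner_diff_right span_singleton)
next
  assume y: "y \<in> plane_normal v \<and> x - y \<in> span {u}"
  then obtain c where c: "x - y = c *\<^sub>R u" by (auto simp: span_singleton)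
  then have x: "x = y + c *\<^sub>R u" by (metis diff_add_cancel add.commute)
  have "v \<bullet> x = c * (v \<bullet> u)" using y by (simp add: x plane_normal_def inner_add_right)
  then show "proj_along u v x = y" using assms by (simp add: proj_along_def x)
qed

end

theory Submission
  imports Defs
begin

text \<open>The unique parent of a face \<open>(y, j)\<close> of the stepped plane under the dual of the
  \<open>i\<close>-th substitution is \<open>(M y, i)\<close> if the height \<open>t\<close> of \<open>y\<close> (its inner product with the normal
  vector) is less than the smallest coordinate \<open>v\<^sub>i\<close>, and \<open>(M y - e\<^sub>i, j)\<close> otherwise: on heights
  this is a greedy expansion along the fully subtractive algorithm. It has to be shown that every
  \<open>y\<close> reaches \<open>0\<close>. A vector with nonnegative coordinates does, because it cannot survive the
  letter \<open>j\<close>. Differences of two orbits that start out as \<open>e\<^sub>k\<close> or \<open>e\<^sub>k - e\<^sub>l\<close> remain, up to sign,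
  nonnegative or permutations of \<open>(1, -1, 0)\<close> and \<open>(1, 1, -1)\<close>; so if one orbit reaches \<open>0\<close>, the
  other becomes nonnegative and reaches \<open>0\<close> too. Steps \<open>\<plusminus>e\<^sub>k\<close>, \<open>e\<^sub>l - e\<^sub>k\<close> connect every admissible \<open>y\<close>
  to a nonnegative vector. Hence every face of the stepped plane lies in some iterate, and finitely
  many of them project onto a given ball.\<close>

section \<open>Heights and small differences\<close>

text \<open>Names the other two letters, so that sums over the alphabet expand around a
  distinguished \<open>i\<close> without a case split on \<open>i\<close>.\<close>

lemma three_letters:
  fixes i :: 3
  obtains k l where "i \<noteq> k" "i \<noteq> l" "k \<noteq> l" "UNIV = {i, k, l}"
proof -
  consider "i = 1" | "i = 2" | "i = 3" using exhaust_3 by blast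
  then show thesis
  proof cases
    case 1 then show thesis using UNIV_3 by (intro that[of 2 3]) simp_all
  next
    case 2
    have "UNIV = {2, 1, 3 :: 3}" unfolding UNIV_3 by (rule insert_commute)
    with 2 show thesis by (intro that[of 1 3]) simp_all
  next
    case 3
    have "UNIV = {3, 1, 2 :: 3}" unfolding UNIV_3 by (metis insert_commute)
    with 3 show thesis by (intro that[of 1 2]) simp_all
  qed
qed

lemma three_letters2:
  fixes i k :: 3
  assumes "i \<noteq> k"
  obtains l where "i \<noteq> l" "k \<noteq> l" "UNIV = {i, k, l}"
proof -
  obtain k' l' where *: "i \<noteq> k'" "i \<noteq> l'" "k' \<noteq> l'" "UNIV = {i, k', l'}"
    by (rule three_letters)
  from *(4) assms have "k = k' \<or> k = l'" by (metis UNIV_I insertE singletonD)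
  then show thesis
  proof
    assume "k = k'" then show thesis using that[of l'] * by metis
  next
    assume "k = l'" then show thesis using that[of k'] * by (metis insert_commute)
  qed
qed

text \<open>For a positive normal vector \<open>v\<close>, the face \<open>(y, j)\<close> belongs to
  the stepped plane exactly when \<open>0 \<le> height v y\<close> and
  \<open>height v y < v $ j\<close>.\<close>

definition height :: "real ^ 3 \<Rightarrow> int ^ 3 \<Rightarrow> real" where
  "height v y = (\<Sum>k\<in>UNIV. v $ k * of_int (y $ k))"

definition coord_sum :: "int ^ 3 \<Rightarrow> int" where
  "coord_sum y = (\<Sum>k\<in>UNIV. y $ k)"

lemma height_eq:
  assumes "UNIV = {i, k, l}" "i \<noteq> k" "i \<noteq> l" "k \<noteq> l"
  shows "height v y = v $ i * of_int (y $ i) + v $ k * of_int (y $ k) + v $ l * of_int (y $ l)"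
  unfolding height_def assms(1) using assms(2-4) by simp

lemma coord_sum_eq:
  assumes "UNIV = {i, k, l}" "i \<noteq> k" "i \<noteq> l" "k \<noteq> l"
  shows "coord_sum y = y $ i + y $ k + y $ l"
  unfolding coord_sum_def assms(1) using assms(2-4) by simp

lemma all_letters_iff:
  assumes "UNIV = {i, k, l :: 3}"
  shows "(\<forall>j. Q j) \<longleftrightarrow> Q i \<and> Q k \<and> Q l"
proof -
  have "(\<forall>j. Q j) \<longleftrightarrow> (\<forall>j\<in>UNIV. Q j)" by simp
  then show ?thesis unfolding assms by simp
qed

lemma height_zero [simp]: "height v 0 = 0"
  by (simp add: height_def)

lemma height_add: "height v (x + y) = height v x + height v y"
  by (simp add: height_def algebra_simps sum.distrib)

lemma height_diff: "height v (x - y) = height v x - height v y"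
  by (simp add: height_def algebra_simps sum_subtractf)

lemma height_uminus: "height v (- y) = - height v y"
  by (simp add: height_def sum_negf)

lemma height_axis [simp]: "height v (axis k 1) = v $ k"
  by (simp add: height_def axis_def if_distrib cong: if_cong)

lemma height_mono:
  assumes "\<And>k. v $ k > 0" "\<And>k. x $ k \<le> y $ k"
  shows "height v x \<le> height v y"
  unfolding height_def using assms by (intro sum_mono mult_left_mono) (auto intro: less_imp_le)

definition nonneg :: "int ^ 3 \<Rightarrow> bool" where
  "nonneg y \<longleftrightarrow> (\<forall>k. 0 \<le> y $ k)"

lemma nonneg_pos_coord:
  assumes "nonneg y" "y \<noteq> 0"
  obtains i where "1 \<le> y $ i"
proof -
  obtain i where "y $ i \<noteq> 0" using assms(2) by (auto simp: vec_eq_iff)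
  moreover have "0 \<le> y $ i" using assms(1) by (simp add: nonneg_def)
  ultimately show thesis using that[of i] by linarith
qed

lemma nonneg_height:
  assumes "\<And>k. v $ k > 0" "nonneg y" "y \<noteq> 0"
  obtains i where "v $ i \<le> height v y"
proof -
  obtain i where "1 \<le> y $ i" using assms(2,3) by (rule nonneg_pos_coord)
  then have "height v (axis i 1) \<le> height v y"
    using assms(1,2) by (intro height_mono) (auto simp: axis_def nonneg_def)
  then show thesis using that[of i] by simp
qed

lemma nonneg_coord_sum:
  assumes "nonneg y" "y \<noteq> 0"
  shows "1 \<le> coord_sum y"
proof -
  obtain i where i: "1 \<le> y $ i" using assms by (rule nonneg_pos_coord)
  have "y $ i \<le> coord_sum y" unfolding coord_sum_def
    using assms(1) by (intro member_le_sum) (auto simp: nonneg_def)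
  then show ?thesis using i by linarith
qed

text \<open>Up to the nonnegative vectors these are the permutations of \<open>(1, -1, 0)\<close> and
  \<open>(1, 1, -1)\<close>.\<close>

definition small_pos :: "int ^ 3 \<Rightarrow> bool" where
  "small_pos d \<longleftrightarrow> nonneg d \<or> ((\<forall>k. \<bar>d $ k\<bar> \<le> 1) \<and> (coord_sum d = 0 \<or> coord_sum d = 1))"

definition small_diff :: "int ^ 3 \<Rightarrow> bool" where
  "small_diff d \<longleftrightarrow> small_pos d \<or> small_pos (- d)"

lemma coord_sum_uminus: "coord_sum (- d) = - coord_sum d"
  by (simp add: coord_sum_def sum_negf)

lemma small_diff_iff:
  "small_diff d \<longleftrightarrow> nonneg d \<or> nonneg (- d) \<or> ((\<forall>k. \<bar>d $ k\<bar> \<le> 1) \<and> \<bar>coord_sum d\<bar> \<le> 1)"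
proof -
  have "\<bar>coord_sum d\<bar> \<le> 1 \<longleftrightarrow> (coord_sum d = 0 \<or> coord_sum d = 1) \<or> (- coord_sum d = 0 \<or> - coord_sum d = 1)"
    by presburger
  moreover have "(\<forall>k. \<bar>(- d) $ k\<bar> \<le> 1) \<longleftrightarrow> (\<forall>k. \<bar>d $ k\<bar> \<le> 1)"
    by simp
  ultimately show ?thesis
    unfolding small_diff_def small_pos_def coord_sum_uminus by blast
qed

text \<open>Otherwise \<open>d\<close> is nonzero with no positive coordinate, or has entries in
  {-1, 0, 1} with sum -1. Up to order the latter is (-1, 0, 0) or (1, -1, -1), of negative height,
  in the second case by the triangle inequality.\<close>

lemma small_diff_orient:
  assumes v: "\<And>k. v $ k > 0" and tri: "\<And>k l m. k \<noteq> l \<Longrightarrow> k \<noteq> m \<Longrightarrow> l \<noteq> m \<Longrightarrow> v $ k < v $ l + v $ m"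
    and d: "small_diff d" and ht: "height v d \<ge> 0"
  shows "small_pos d"
proof (rule ccontr)
  assume nd: "\<not> small_pos d"
  obtain i k l :: 3 where ikl: "i \<noteq> k" "i \<noteq> l" "k \<noteq> l" "UNIV = {i, k, l}" using three_letters by metis
  note h = height_eq[OF ikl(4,1-3)] and s = coord_sum_eq[OF ikl(4,1-3)]
  have t: "v $ i < v $ k + v $ l" "v $ k < v $ l + v $ i" "v $ l < v $ i + v $ k"
    by (rule tri; use ikl in auto)+
  have "small_pos (- d)" using d nd by (simp add: small_diff_def)
  then consider "nonneg (- d)" | "\<forall>k. \<bar>d $ k\<bar> \<le> 1" "coord_sum d = 0" | "\<forall>k. \<bar>d $ k\<bar> \<le> 1" "coord_sum d = -1"
    unfolding small_pos_def by (auto simp: coord_sum_uminus)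
  then show False
  proof cases
    case 1
    have "- d \<noteq> 0" using nd by (auto simp: small_pos_def nonneg_def)
    then obtain j where "v $ j \<le> height v (- d)" using v 1 by (metis nonneg_height)
    then show False using ht v[of j] by (simp add: height_uminus)
  next
    case 2
    then show False using nd by (simp add: small_pos_def)
  next
    case 3
    have "\<bar>d $ i\<bar> \<le> 1" "\<bar>d $ k\<bar> \<le> 1" "\<bar>d $ l\<bar> \<le> 1" using 3 by auto
    then have "(d $ i = -1 \<or> d $ i = 0 \<or> d $ i = 1) \<and> (d $ k = -1 \<or> d $ k = 0 \<or> d $ k = 1)
      \<and> (d $ l = -1 \<or> d $ l = 0 \<or> d $ l = 1)" by linarith
    then show False using 3(2) ht t v[of i] v[of k] v[of l] unfolding h s
      by (elim conjE disjE) simp_all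
  qed
qed

text \<open>Adds the coordinate sum of \<open>y\<close>, minus \<open>c\<close>, at the letter \<open>i\<close>: this is
  \<open>M y - c e\<^sub>i\<close> for the incidence matrix \<open>M\<close> of the \<open>i\<close>-th substitution.\<close>

definition update :: "3 \<Rightarrow> int \<Rightarrow> int ^ 3 \<Rightarrow> int ^ 3" where
  "update i c y = (\<chi> k. if k = i then coord_sum y - c else y $ k)"

lemma update_nth [simp]: "update i c y $ k = (if k = i then coord_sum y - c else y $ k)"
  by (simp add: update_def)

lemma coord_sum_diff: "coord_sum (x - y) = coord_sum x - coord_sum y"
  by (simp add: coord_sum_def sum_subtractf)

lemma update_diff: "update i c x - update i c' y = update i (c - c') (x - y)"
  by (simp add: vec_eq_iff coord_sum_diff)

text \<open>Multiplication by the transposed incidence matrix of the \<open>i\<close>-th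
  substitution; it undoes the subtraction of entry \<open>i\<close> from the other two.\<close>

definition transfer :: "3 \<Rightarrow> real ^ 3 \<Rightarrow> real ^ 3" where
  "transfer i v = (\<chi> k. if k = i then v $ i else v $ k + v $ i)"

lemma transfer_nth [simp]: "transfer i v $ k = (if k = i then v $ i else v $ k + v $ i)"
  by (simp add: transfer_def)

lemma height_update: "height v (update i c y) = height (transfer i v) y - of_int c * v $ i"
proof -
  obtain k l where ikl: "i \<noteq> k" "i \<noteq> l" "k \<noteq> l" "UNIV = {i, k, l}" using three_letters by metis
  show ?thesis
    unfolding height_eq[OF ikl(4,1-3)] using ikl(1-3)
    by (simp add: coord_sum_eq[OF ikl(4,1-3)] algebra_simps)
qed

text \<open>One step of the fully subtractive algorithm with positive vectors \<open>transfer i v\<close> and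
  \<open>v\<close>, whose first has its minimum at \<open>i\<close>.\<close>

lemma small_diff_update:
  assumes v: "\<And>k. v $ k > 0"
    and d: "small_pos d" and ht: "height (transfer i v) d \<ge> 0"
    and c: "c = 0 \<or> c = 1" and c0: "d = 0 \<Longrightarrow> c = 0"
  shows "small_diff (update i c d)"
proof -
  obtain k l where ikl: "i \<noteq> k" "i \<noteq> l" "k \<noteq> l" "UNIV = {i, k, l}" using three_letters by metis
  note h = height_eq[OF ikl(4,1-3)] and s = coord_sum_eq[OF ikl(4,1-3)]
    and al = all_letters_iff[OF ikl(4)]
  show ?thesis
  proof (cases "nonneg d")
    case True
    then have "coord_sum d \<ge> c"
      using nonneg_coord_sum[of d] c c0 by (cases "d = 0") (auto simp: coord_sum_def)
    then have "nonneg (update i c d)" using True by (auto simp: nonneg_def)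
    then show ?thesis by (simp add: small_diff_iff)
  next
    case False
    define p q r where pqr: "p = d $ i" "q = d $ k" "r = d $ l"
    define a b e where abe: "a = v $ i" "b = v $ k" "e = v $ l"
    have pos: "a > 0" "b > 0" "e > 0" using v by (auto simp: abe)
    have *: "\<bar>p\<bar> \<le> 1" "\<bar>q\<bar> \<le> 1" "\<bar>r\<bar> \<le> 1" "p + q + r = 0 \<or> p + q + r = 1"
      using d False unfolding small_pos_def s pqr by auto
    have nn: "\<not> (0 \<le> p \<and> 0 \<le> q \<and> 0 \<le> r)" using False unfolding nonneg_def al pqr .
    have ht': "0 \<le> a * p + (b + a) * q + (e + a) * r"
      using ht ikl unfolding h pqr abe by simp
    have "(p = -1 \<or> p = 0 \<or> p = 1) \<and> (q = -1 \<or> q = 0 \<or> q = 1) \<and> (r = -1 \<or> r = 0 \<or> r = 1)"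
      using * by linarith
    \<comment> \<open>Only \<open>p = 1\<close> with sum 0 and \<open>c = 1\<close> would leave the
      class, with new coordinate sum -2; but there \<open>q\<close> and \<open>r\<close> are -1 and
      0 in some order, so the height would be \<open>- b\<close> or \<open>- e\<close>.\<close>
    then have "(0 \<le> p + q + r - c \<and> 0 \<le> q \<and> 0 \<le> r) \<or>
        \<bar>p + q + r - c\<bar> \<le> 1 \<and> \<bar>p + q + r - c + q + r\<bar> \<le> 1"
      using *(4) nn ht' pos c by (elim conjE disjE) simp_all
    then show ?thesis using *(2,3) ikl(1-3)
      unfolding small_diff_iff nonneg_def al by (auto simp: s pqr)
  qed
qed

section \<open>The fully subtractive algorithm\<close>

lemma small_diff_uminus: "small_diff (- d) \<longleftrightarrow> small_diff d"
  by (auto simp: small_diff_def)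

text \<open>Positivity turns \<open>rec\<close> into a genuine subtractive step:
  \<open>w (Suc n)\<close> arises from \<open>w n\<close> by subtracting its strictly smallest
  entry, at \<open>a n\<close>, from the other two.\<close>

locale fully_subtractive =
  fixes a :: "nat \<Rightarrow> 3" and w :: "nat \<Rightarrow> real ^ 3"
  assumes pos: "w n $ k > 0"
    and rec: "w n = transfer (a n) (w (Suc n))"
    and infinitely_often: "\<exists>m\<ge>n. a m = k"
begin

lemma w_same: "w (Suc n) $ a n = w n $ a n"
  by (subst (2) rec) simp

lemma w_other: "k \<noteq> a n \<Longrightarrow> w (Suc n) $ k = w n $ k - w n $ a n"
  by (subst (2 3) rec) simp

lemma w_less: "k \<noteq> a n \<Longrightarrow> w n $ a n < w n $ k"
  using w_other[of k n] pos[of "Suc n" k] by simp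

lemma w_min: "w n $ a n \<le> w n $ k"
  using w_less[of k n] by (cases "k = a n") auto

text \<open>A violated triangle inequality persists, and its large letter is never the minimum.\<close>

lemma triangle:
  assumes "k \<noteq> l" "k \<noteq> m" "l \<noteq> m"
  shows "w n $ k < w n $ l + w n $ m"
proof (rule ccontr)
  assume contra: "\<not> ?thesis"
  have letters: "a i = k \<or> a i = l \<or> a i = m" for i
  proof -
    obtain m' where "UNIV = {k, l, m'}" using three_letters2[OF assms(1)] by metis
    then show ?thesis using assms by (metis UNIV_I insertE singletonD)
  qed
  have never: "a i \<noteq> k" if "w i $ k \<ge> w i $ l + w i $ m" for i
    using that pos[of i l] w_less[of m i] assms by (auto simp: not_less)
  have "w i $ k \<ge> w i $ l + w i $ m" if "n \<le> i" for i
    using that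
  proof (induction i rule: dec_induct)
    case base
    then show ?case using contra by simp
  next
    case (step i)
    then have "a i \<noteq> k" using never by blast
    with letters consider "a i = l" | "a i = m" by blast
    then show ?case
      using step.IH assms w_same[of i] w_other[of k i] w_other[of l i] w_other[of m i] by cases auto
  qed
  then show False using never infinitely_often by metis
qed

section \<open>Greedy digits and orbits of integer vectors\<close>

definition digit :: "nat \<Rightarrow> int ^ 3 \<Rightarrow> int" where
  "digit n y = (if w n $ a n \<le> height (w n) y then 1 else 0)"

text \<open>The base point of the parent face: digit 0 selects the final letter \<open>a n\<close>
  with empty suffix, digit 1 the letter followed by the suffix \<open>[a n]\<close>.\<close>

definition step :: "nat \<Rightarrow> int ^ 3 \<Rightarrow> int ^ 3" where
  "step n y = update (a n) (digit n y) y"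

primrec orbit :: "int ^ 3 \<Rightarrow> nat \<Rightarrow> int ^ 3" where
  "orbit y 0 = y"
| "orbit y (Suc n) = step n (orbit y n)"

lemma height_step: "height (w (Suc n)) (step n y) = height (w n) y - of_int (digit n y) * w n $ a n"
  unfolding step_def height_update by (simp add: rec[symmetric] w_same)

lemma height_orbit_nonneg:
  assumes "0 \<le> height (w 0) y"
  shows "0 \<le> height (w n) (orbit y n)"
  by (induction n) (use assms in \<open>auto simp: height_step digit_def\<close>)

lemma step_zero [simp]: "step n 0 = 0"
  using pos[of n "a n"] by (auto simp: step_def digit_def vec_eq_iff coord_sum_def)

lemma orbit_zero:
  assumes "orbit y n = 0" "n \<le> m"
  shows "orbit y m = 0"
  using assms(2) by (induction m rule: dec_induct) (use assms(1) in auto)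

primrec orbit_type :: "int ^ 3 \<Rightarrow> 3 \<Rightarrow> nat \<Rightarrow> 3" where
  "orbit_type y j 0 = j"
| "orbit_type y j (Suc n) = (if digit n (orbit y n) = 0 then a n else orbit_type y j n)"

text \<open>Digit 1 is impossible at type \<open>a n\<close>, so then the entry of the type and the
  height drop by the same amount. Digit 0 means that the height is below the entry at
  \<open>a n\<close>, the new type.\<close>

lemma orbit_less_type:
  assumes "height (w 0) y < w 0 $ j"
  shows "height (w n) (orbit y n) < w n $ orbit_type y j n"
proof (induction n)
  case (Suc n)
  show ?case
  proof (cases "digit n (orbit y n) = 0")
    case True
    then show ?thesis by (auto simp: height_step digit_def w_same split: if_splits)
  next
    case False
    then have "orbit_type y j n \<noteq> a n" using Suc by (auto simp: digit_def)
    then show ?thesis using False Suc by (auto simp: height_step digit_def w_other)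
  qed
qed (use assms in simp)

text \<open>A nonnegative nonzero vector of height less than the entry at \<open>j\<close> keeps its digit
  \<open>1\<close>, hence stays such a vector, but it cannot survive a step with letter \<open>j\<close>.\<close>

lemma nonneg_orbit_vanishes:
  assumes "nonneg (orbit y n)" "height (w n) (orbit y n) < w n $ j"
  shows "\<exists>m. orbit y m = 0"
proof (rule ccontr)
  assume nz: "\<not> ?thesis"
  have d: "w i $ a i \<le> height (w i) (orbit y i)" if nn: "nonneg (orbit y i)" for i
  proof -
    obtain k where "w i $ k \<le> height (w i) (orbit y i)"
      using nonneg_height[OF pos nn] nz by metis
    then show ?thesis using w_min[of i k] by linarith
  qed
  have "nonneg (orbit y i) \<and> height (w i) (orbit y i) < w i $ j" if "n \<le> i" for i
    using that
  proof (induction i rule: dec_induct)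
    case base
    then show ?case using assms by simp
  next
    case (step i)
    then have "digit i (orbit y i) = 1" using d by (simp add: digit_def)
    moreover have "1 \<le> coord_sum (orbit y i)" using step.IH nz by (intro nonneg_coord_sum) auto
    moreover have "a i \<noteq> j" using d step.IH by force
    ultimately show ?case using step.IH
      by (auto simp: height_step w_other nonneg_def) (auto simp: step_def)
  qed
  then show False using d infinitely_often[of n j] by force
qed

section \<open>Differences of two orbits\<close>

lemma small_diff_step:
  assumes "small_diff (x - y)"
  shows "small_diff (step n x - step n y)"
proof -
  \<comment> \<open>By symmetry \<open>x\<close> may be taken to have the larger height; then its
    digit exceeds that of \<open>y\<close> by 0 or 1.\<close>
  have *: "small_diff (step n x - step n y)"
    if d: "small_diff (x - y)" and le: "height (w n) y \<le> height (w n) x" for x y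
  proof -
    have "small_pos (x - y)"
      using le by (intro small_diff_orient[OF pos[of n] triangle[of _ _ _ n] d]) (auto simp: height_diff)
    then have "small_diff (update (a n) (digit n x - digit n y) (x - y))"
      using le by (intro small_diff_update[OF pos[of "Suc n"]])
        (auto simp: rec[symmetric] height_diff digit_def)
    then show ?thesis by (simp add: step_def update_diff)
  qed
  show ?thesis
  proof (cases "height (w n) y \<le> height (w n) x")
    case True
    then show ?thesis using * assms by blast
  next
    case False
    then have "small_diff (step n y - step n x)"
      using assms small_diff_uminus[of "x - y"] by (intro *) auto
    then show ?thesis using small_diff_uminus[of "step n x - step n y"] by simp
  qed
qed

lemma small_diff_orbit:
  assumes "small_diff (x - y)"
  shows "small_diff (orbit x n - orbit y n)"
  by (induction n) (use assms small_diff_step in auto)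

text \<open>A permutation of (1, -1, 0) with 1 at \<open>a n\<close> has negative height. With 0
  there, the triangle inequality keeps the height below the minimum and the digit is 0; with -1
  there, digit 0 would give a nonnegative vector, so the digit is 1. Both times the vector is
  fixed.\<close>

lemma stuck_sum_zero:
  assumes "\<not> nonneg g" "\<forall>k. \<bar>g $ k\<bar> \<le> 1" "coord_sum g = 0" "0 \<le> height (w n) g"
    and st: "\<not> nonneg (step n g)"
  shows "step n g = g" "g $ a n \<noteq> 1"
proof -
  obtain k l where ikl: "a n \<noteq> k" "a n \<noteq> l" "k \<noteq> l" "UNIV = {a n, k, l}"
    using three_letters by metis
  note h = height_eq[OF ikl(4,1-3)] and s = coord_sum_eq[OF ikl(4,1-3)]
    and al = all_letters_iff[OF ikl(4)]
  define p q r where pqr: "p = g $ a n" "q = g $ k" "r = g $ l"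
  define b d e where abe: "b = w n $ a n" "d = w n $ k" "e = w n $ l"
  have pos: "b > 0" "b < d" "b < e" "d < b + e" "e < b + d"
    using pos[of n "a n"] w_less[of k n] w_less[of l n] triangle[of k "a n" l n]
      triangle[of l "a n" k n] ikl(1-3) by (auto simp: abe)
  have "\<bar>p\<bar> \<le> 1 \<and> \<bar>q\<bar> \<le> 1 \<and> \<bar>r\<bar> \<le> 1" and sum: "p + q + r = 0"
    using assms(2,3) unfolding s pqr by auto
  then have c: "(p = -1 \<or> p = 0 \<or> p = 1) \<and> (q = -1 \<or> q = 0 \<or> q = 1) \<and> (r = -1 \<or> r = 0 \<or> r = 1)"
    by linarith
  have nn: "\<not> (0 \<le> p \<and> 0 \<le> q \<and> 0 \<le> r)" using assms(1) unfolding nonneg_def al pqr .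
  have ht: "0 \<le> b * p + d * q + e * r" using assms(4) unfolding h pqr abe by simp
  have dig: "digit n g = (if b \<le> b * p + d * q + e * r then 1 else 0)"
    unfolding digit_def h pqr abe ..
  have st': "\<not> (digit n g \<le> 0 \<and> 0 \<le> q \<and> 0 \<le> r)"
    using st assms(3) ikl(1-3) unfolding nonneg_def al pqr by (simp add: step_def)
  have "digit n g = - p \<and> p \<noteq> 1"
    using c sum nn ht st' pos unfolding dig by (elim conjE disjE) (simp_all split: if_splits)
  then show "step n g = g" "g $ a n \<noteq> 1"
    using assms(3) by (auto simp: step_def vec_eq_iff pqr)
qed

text \<open>The vector is a permutation of (1, 1, -1). A -1 at \<open>a n\<close> would be replaced
  by 0 or 1, giving a nonnegative vector; a 1 there stays or becomes 0 according to the
  digit.\<close>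

lemma stuck_sum_one:
  assumes "\<not> nonneg g" "\<forall>k. \<bar>g $ k\<bar> \<le> 1" "coord_sum g = 1"
    and st: "\<not> nonneg (step n g)"
  shows "coord_sum (step n g) = 0 \<or> step n g = g" "g $ a n \<noteq> -1"
proof -
  obtain k l where ikl: "a n \<noteq> k" "a n \<noteq> l" "k \<noteq> l" "UNIV = {a n, k, l}"
    using three_letters by metis
  note s = coord_sum_eq[OF ikl(4,1-3)] and al = all_letters_iff[OF ikl(4)]
  define p q r where pqr: "p = g $ a n" "q = g $ k" "r = g $ l"
  have "\<bar>p\<bar> \<le> 1 \<and> \<bar>q\<bar> \<le> 1 \<and> \<bar>r\<bar> \<le> 1" and sum: "p + q + r = 1"
    using assms(2,3) unfolding s pqr by auto
  then have c: "(p = -1 \<or> p = 0 \<or> p = 1) \<and> (q = -1 \<or> q = 0 \<or> q = 1) \<and> (r = -1 \<or> r = 0 \<or> r = 1)"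
    by linarith
  have nn: "\<not> (0 \<le> p \<and> 0 \<le> q \<and> 0 \<le> r)" using assms(1) unfolding nonneg_def al pqr .
  have d: "digit n g = 0 \<or> digit n g = 1" by (simp add: digit_def)
  have st': "\<not> (digit n g \<le> 1 \<and> 0 \<le> q \<and> 0 \<le> r)"
    using st assms(3) ikl(1-3) unfolding nonneg_def al pqr by (simp add: step_def)
  have "p = 1 \<and> q + r = 0"
    using c sum nn st' d by (elim conjE disjE) simp_all
  moreover have "step n g $ a n = 1 - digit n g" "step n g $ k = q" "step n g $ l = r"
    using assms(3) ikl(1-3) by (auto simp: step_def pqr)
  ultimately show "g $ a n \<noteq> -1" "coord_sum (step n g) = 0 \<or> step n g = g"
    using d s[of "step n g"] by (auto simp: pqr vec_eq_iff al)
qed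

lemma small_pos_orbit_nonneg:
  assumes sp: "\<And>n. n \<ge> N \<Longrightarrow> small_pos (orbit y n)"
    and ht: "\<And>n. 0 \<le> height (w n) (orbit y n)"
  shows "\<exists>n. nonneg (orbit y n)"
proof (rule ccontr)
  assume nn: "\<not> ?thesis"
  have b: "\<forall>k. \<bar>orbit y n $ k\<bar> \<le> 1" "coord_sum (orbit y n) = 0 \<or> coord_sum (orbit y n) = 1"
    if "n \<ge> N" for n
    using sp[OF that] nn by (auto simp: small_pos_def)
  \<comment> \<open>Sum 0, once reached, persists, and the letter with coordinate 1 can no longer
    occur; if it is never reached, the sum stays 1 and the letter with coordinate -1 cannot occur.
    In both cases the orbit is eventually constant, against \<open>infinitely_often\<close>.\<close>
  show False
  proof (cases "\<exists>n\<ge>N. coord_sum (orbit y n) = 0")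
    case True
    then obtain n where n: "n \<ge> N" "coord_sum (orbit y n) = 0" by blast
    have "\<not> (\<forall>k. orbit y n $ k \<le> 0)"
    proof
      assume np: "\<forall>k. orbit y n $ k \<le> 0"
      then have "nonneg (- orbit y n)" by (simp add: nonneg_def)
      then have "orbit y n = 0"
        using nonneg_coord_sum[of "- orbit y n"] n(2) by (auto simp: coord_sum_uminus)
      then show False using nn by (metis nonneg_def order_refl zero_index)
    qed
    then obtain k where "orbit y n $ k > 0" by (meson not_le)
    then have k: "orbit y n $ k = 1" using b(1)[OF n(1)] by (smt (verit))
    have c: "orbit y m = orbit y n" if "n \<le> m" for m
      using that
    proof (induction m rule: dec_induct)
      case (step m)
      then show ?case using stuck_sum_zero(1)[of "orbit y m" m] nn b(1)[of m] n ht[of m]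
        by (metis le_trans orbit.simps(2))
    qed simp
    obtain m where m: "m \<ge> n" "a m = k" using infinitely_often by blast
    then show False using stuck_sum_zero(2)[of "orbit y m" m] c[of m] k nn b(1)[of m] n ht[of m]
      by (metis le_trans orbit.simps(2))
  next
    case False
    obtain k where "orbit y N $ k < 0" using nn unfolding nonneg_def by (meson not_le)
    moreover have "\<bar>orbit y N $ k\<bar> \<le> 1" using b(1)[of N] by simp
    ultimately have k: "orbit y N $ k = -1" by linarith
    have c: "orbit y m = orbit y N" if "N \<le> m" for m
      using that
    proof (induction m rule: dec_induct)
      case (step m)
      then show ?case using stuck_sum_one(1)[of "orbit y m" m] nn b[of m] False
        by (metis le_Suc_eq orbit.simps(2))
    qed simp
    obtain m where m: "m \<ge> N" "a m = k" using infinitely_often by blast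
    then show False using stuck_sum_one(2)[of "orbit y m" m] c[of m] k nn b[of m] False
      by (metis orbit.simps(2))
  qed
qed

text \<open>Once the orbit of \<open>x\<close> is 0, the difference of the two orbits is the orbit
  of \<open>y\<close> itself, hence small; its nonnegative height fixes the sign.\<close>

lemma vanishing_small_diff:
  assumes "orbit x N = 0" "small_diff (y - x)" "0 \<le> height (w 0) y" "height (w 0) y < w 0 $ j"
  shows "\<exists>n. orbit y n = 0"
proof -
  have "small_pos (orbit y n)" if "n \<ge> N" for n
  proof (rule small_diff_orient[OF pos[of n] triangle[of _ _ _ n]])
    show "small_diff (orbit y n)"
      using small_diff_orbit[OF assms(2), of n] orbit_zero[OF assms(1) that] by simp
  qed (use height_orbit_nonneg assms(3) in auto)
  then obtain n where "nonneg (orbit y n)"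
    using small_pos_orbit_nonneg height_orbit_nonneg assms(3) by blast
  then show ?thesis using nonneg_orbit_vanishes orbit_less_type assms(4) by blast
qed

lemma small_diff_moves:
  "small_diff (axis k 1)" "small_diff (- axis k 1)" "small_diff (axis k 1 - axis l 1)"
  by (auto simp: small_diff_iff nonneg_def axis_def coord_sum_diff)
    (auto simp: coord_sum_def axis_def if_distrib cong: if_cong)

text \<open>Induction on the sum of the absolute values of the coordinates: if \<open>y\<close> has a positive
  coordinate \<open>k\<close> and a negative coordinate \<open>l\<close>, one of \<open>y - e\<^sub>k\<close>,
  \<open>y + e\<^sub>l\<close>, \<open>y - e\<^sub>k + e\<^sub>l\<close> keeps the height in the admissible range.\<close>

theorem orbit_vanishes:
  assumes "0 \<le> height (w 0) y" "height (w 0) y < w 0 $ j"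
  shows "\<exists>n. orbit y n = 0"
  using assms
proof (induction "nat (\<Sum>k\<in>UNIV. \<bar>y $ k\<bar>)" arbitrary: y j rule: less_induct)
  case less
  show ?case
  proof (cases "nonneg y")
    case True
    then show ?thesis using nonneg_orbit_vanishes[of y 0 j] less.prems by simp
  next
    case False
    then obtain l where l: "y $ l < 0" by (auto simp: nonneg_def not_le)
    have "\<exists>k. y $ k > 0"
    proof (rule ccontr)
      assume "\<not> ?thesis"
      then have n: "nonneg (- y)" "- y \<noteq> 0" using l by (auto simp: nonneg_def not_less)
      obtain i where "w 0 $ i \<le> height (w 0) (- y)" using nonneg_height[OF pos n] by blast
      then show False using less.prems(1) pos[of 0 i] by (simp add: height_uminus)
    qed
    then obtain k where k: "y $ k > 0" by blast
    have "k \<noteq> l" using k l by auto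
    have dec: "\<exists>n. orbit y n = 0"
      if z: "small_diff (y - z)" "0 \<le> height (w 0) z" "height (w 0) z < w 0 $ j'"
        and le: "\<And>m. \<bar>z $ m\<bar> \<le> \<bar>y $ m\<bar>" and lt: "\<bar>z $ m\<bar> < \<bar>y $ m\<bar>" for z j' m
    proof -
      have "(\<Sum>k\<in>UNIV. \<bar>z $ k\<bar>) < (\<Sum>k\<in>UNIV. \<bar>y $ k\<bar>)"
        using le lt by (intro sum_strict_mono_ex1) auto
      then have "nat (\<Sum>k\<in>UNIV. \<bar>z $ k\<bar>) < nat (\<Sum>k\<in>UNIV. \<bar>y $ k\<bar>)"
        by (subst nat_less_eq_zless) (auto intro: sum_nonneg)
      then obtain N where "orbit z N = 0" using less.hyps z(2,3) by blast
      then show ?thesis using vanishing_small_diff z(1) less.prems by blast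
    qed
    \<comment> \<open>The type bounding the height changes with the move: \<open>j\<close>,
      \<open>k\<close> and \<open>l\<close> in the three cases.\<close>
    consider "w 0 $ k \<le> height (w 0) y" | "height (w 0) y + w 0 $ l < w 0 $ k"
      | "height (w 0) y < w 0 $ k" "w 0 $ k \<le> height (w 0) y + w 0 $ l" by linarith
    then show ?thesis
    proof cases
      case 1
      show ?thesis
        by (rule dec[of "y - axis k 1" j k])
          (use 1 less.prems pos[of 0 k] k small_diff_moves in \<open>auto simp: height_diff, auto simp: axis_def\<close>)
    next
      case 2
      show ?thesis
        by (rule dec[of "y + axis l 1" k l])
          (use 2 less.prems pos[of 0 l] l small_diff_moves in \<open>auto simp: height_add, auto simp: axis_def\<close>)
    next
      case 3
      show ?thesis
        by (rule dec[of "y - (axis k 1 - axis l 1)" l k])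
          (use 3 less.prems k l \<open>k \<noteq> l\<close> small_diff_moves in \<open>auto simp: height_diff, auto simp: axis_def\<close>)
    qed
  qed
qed

end

section \<open>Parents of faces under the dual substitution\<close>

definition word_morphism :: "(word3 \<Rightarrow> word3) \<Rightarrow> bool" where
  "word_morphism \<sigma> \<longleftrightarrow> (\<forall>x y. \<sigma> (x @ y) = \<sigma> x @ \<sigma> y)"

lemma word_morphism_append: "word_morphism \<sigma> \<Longrightarrow> \<sigma> (x @ y) = \<sigma> x @ \<sigma> y"
  by (simp add: word_morphism_def)

lemma word_morphism_Nil: "word_morphism \<sigma> \<Longrightarrow> \<sigma> [] = []"
  using word_morphism_append[of \<sigma> "[]" "[]"] by simp

lemma arnoux_rauzy_morphism: "word_morphism (arnoux_rauzy i)"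
  by (simp add: word_morphism_def arnoux_rauzy_def morphism_of_def)

lemma arnoux_rauzy_letter: "arnoux_rauzy i [j] = (if j = i then [i] else [j, i])"
  by (simp add: arnoux_rauzy_def morphism_of_def)

lemma arnoux_rauzy_product_simps [simp]:
  "arnoux_rauzy_product [] = (\<lambda>x. x)"
  "arnoux_rauzy_product (i # ks) = arnoux_rauzy i \<circ> arnoux_rauzy_product ks"
  by (simp_all add: arnoux_rauzy_product_def fun_eq_iff)

lemma abelianization_append: "abelianization (x @ y) = abelianization x + abelianization y"
  by (simp add: abelianization_def vec_eq_iff)

lemma abelianization_Nil [simp]: "abelianization [] = 0"
  by (simp add: abelianization_def vec_eq_iff)

lemma abelianization_letter: "abelianization [j] = axis j 1"
  by (simp add: abelianization_def vec_eq_iff axis_def)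

lemma abelianization_morphism:
  fixes \<sigma> :: "word3 \<Rightarrow> word3"
  assumes "word_morphism \<sigma>"
  shows "abelianization (\<sigma> x) = (incidence_matrix \<sigma> *v abelianization x :: 'a::comm_ring_1 ^ 3)"
proof (induction x)
  case (Cons j x)
  have "(incidence_matrix \<sigma> *v axis j 1 :: 'a ^ 3) = abelianization (\<sigma> [j])"
    by (simp add: vec_eq_iff matrix_vector_mult_def axis_def incidence_matrix_def abelianization_def
        if_distrib cong: if_cong)
  then show ?case
    using Cons word_morphism_append[OF assms, of "[j]" x] abelianization_append[of "[j]" x, where 'a='a]
    by (simp add: abelianization_append abelianization_letter matrix_vector_right_distrib)
qed (simp add: word_morphism_Nil[OF assms])

lemma incidence_matrix_comp:
  assumes "word_morphism \<sigma>"
  shows "incidence_matrix (\<sigma> \<circ> \<tau>) = (incidence_matrix \<sigma> ** incidence_matrix \<tau> :: 'a::comm_ring_1 ^ 3 ^ 3)"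
proof -
  have "(incidence_matrix (\<sigma> \<circ> \<tau>) :: 'a ^ 3 ^ 3) $ r $ j = (incidence_matrix \<sigma> ** incidence_matrix \<tau>) $ r $ j" for r j
  proof -
    have "(incidence_matrix (\<sigma> \<circ> \<tau>) :: 'a ^ 3 ^ 3) $ r $ j = abelianization (\<sigma> (\<tau> [j])) $ r"
      by (simp add: incidence_matrix_def abelianization_def)
    also have "\<dots> = (incidence_matrix \<sigma> ** incidence_matrix \<tau>) $ r $ j"
      unfolding abelianization_morphism[OF assms]
      by (simp add: matrix_vector_mult_def matrix_matrix_mult_def abelianization_def incidence_matrix_def)
    finally show ?thesis .
  qed
  then show ?thesis by (simp add: vec_eq_iff)
qed

lemma incidence_matrix_id: "incidence_matrix (\<lambda>x. x) = mat 1"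
  by (simp add: incidence_matrix_def mat_def vec_eq_iff)

section \<open>Incidence matrices of the Arnoux-Rauzy substitutions and their products\<close>

lemma incidence_matrix_arnoux_rauzy:
  "incidence_matrix (arnoux_rauzy i) = (\<chi> r j. if r = j \<or> r = i then 1 else 0)"
  by (auto simp: incidence_matrix_def arnoux_rauzy_letter vec_eq_iff)

lemma arnoux_rauzy_mult: "incidence_matrix (arnoux_rauzy i) *v y = update i 0 y"
proof -
  obtain k l where ikl: "i \<noteq> k" "i \<noteq> l" "k \<noteq> l" "UNIV = {i, k, l}" by (rule three_letters)
  show ?thesis
    unfolding vec_eq_iff all_letters_iff[OF ikl(4)] matrix_vector_mult_def
      incidence_matrix_arnoux_rauzy ikl(4) update_nth coord_sum_eq[OF ikl(4,1-3)]
    using ikl(1-3) by auto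
qed

lemma transpose_arnoux_rauzy_mult: "transpose (incidence_matrix (arnoux_rauzy i)) *v v = transfer i v"
proof -
  obtain k l where ikl: "i \<noteq> k" "i \<noteq> l" "k \<noteq> l" "UNIV = {i, k, l}" by (rule three_letters)
  show ?thesis
    unfolding vec_eq_iff all_letters_iff[OF ikl(4)] matrix_vector_mult_def transpose_def ikl(4)
      incidence_matrix_arnoux_rauzy
    using ikl(1-3) by auto
qed

lemma invertible_arnoux_rauzy: "invertible (incidence_matrix (arnoux_rauzy i) :: int ^ 3 ^ 3)"
  unfolding invertible_def incidence_matrix_arnoux_rauzy
\<comment> \<open>The inverse subtracts the other two coordinates from coordinate
  \<open>i\<close>.\<close>
proof (intro exI[of _ "\<chi> r j. if r = j then 1 else if r = i then - 1 else 0"] conjI)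
qed (use exhaust_3[of i] in
    \<open>auto simp: vec_eq_iff forall_3 matrix_matrix_mult_def sum_3 mat_def\<close>)

lemma invertible_arnoux_rauzy_product:
  "invertible (incidence_matrix (arnoux_rauzy_product ks) :: int ^ 3 ^ 3)"
proof (induction ks)
  case Nil
  have "invertible (mat 1 :: int ^ 3 ^ 3)" unfolding invertible_def by (intro exI[of _ "mat 1"]) simp
  then show ?case by (simp add: incidence_matrix_id)
next
  case (Cons i ks)
  obtain A where A: "incidence_matrix (arnoux_rauzy i) ** A = (mat 1 :: int ^ 3 ^ 3)"
    "A ** incidence_matrix (arnoux_rauzy i) = mat 1"
    using invertible_arnoux_rauzy[of i] unfolding invertible_def by blast
  obtain B where B: "incidence_matrix (arnoux_rauzy_product ks) ** B = (mat 1 :: int ^ 3 ^ 3)"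
    "B ** incidence_matrix (arnoux_rauzy_product ks) = mat 1"
    using Cons unfolding invertible_def by blast
  show ?case
    unfolding invertible_def arnoux_rauzy_product_simps incidence_matrix_comp[OF arnoux_rauzy_morphism]
    by (rule exI[of _ "B ** A"]) (metis A B matrix_mul_assoc matrix_mul_lid)
qed

text \<open>Transposition reverses products, so the outermost substitution is transferred first and
  \<open>fold\<close> runs through \<open>ks\<close> from the head.\<close>

lemma transpose_arnoux_rauzy_product_mult:
  "transpose (incidence_matrix (arnoux_rauzy_product ks)) *v v = fold transfer ks v"
proof (induction ks arbitrary: v)
  case Nil
  then show ?case by (simp add: incidence_matrix_id)
next
  case (Cons i ks)
  show ?case
    unfolding arnoux_rauzy_product_simps incidence_matrix_comp[OF arnoux_rauzy_morphism]
      matrix_transpose_mul matrix_vector_mul_assoc[symmetric] transpose_arnoux_rauzy_mult Cons fold_simps ..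
qed

lemma transfer_scaleR: "transfer i (c *\<^sub>R v) = c *\<^sub>R transfer i v"
  by (simp add: vec_eq_iff algebra_simps)

lemma fold_transfer_pos:
  assumes "\<And>k. v $ k > 0"
  shows "fold transfer ks v $ k > 0"
  using assms
proof (induction ks arbitrary: v k)
  case (Cons i ks)
  show ?case unfolding fold_simps by (rule Cons.IH) (use Cons.prems in \<open>auto intro: add_pos_pos\<close>)
qed simp

text \<open>The inverse of the incidence matrix is cleared from the definition of the dual
  substitution.\<close>

definition parent_face :: "(word3 \<Rightarrow> word3) \<Rightarrow> face \<Rightarrow> face \<Rightarrow> bool" where
  "parent_face \<sigma> = (\<lambda>(y, j) (x, i).
     \<exists>p s. \<sigma> [j] = p @ [i] @ s \<and> incidence_matrix \<sigma> *v y = x + abelianization s)"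

lemma parent_face_dual_face:
  assumes inv: "invertible (incidence_matrix \<sigma> :: int ^ 3 ^ 3)" and "parent_face \<sigma> F G"
  shows "F \<in> dual_face \<sigma> G"
proof -
  obtain y j x i where FG: "F = (y, j)" "G = (x, i)" by (metis surj_pair)
  obtain p s where ps: "\<sigma> [j] = p @ [i] @ s" "incidence_matrix \<sigma> *v y = x + abelianization s"
    using assms(2) unfolding parent_face_def FG by auto
  let ?M = "incidence_matrix \<sigma> :: int ^ 3 ^ 3"
  have "?M ** matrix_inv ?M = mat 1 \<and> matrix_inv ?M ** ?M = mat 1"
    using inv unfolding invertible_def matrix_inv_def by (rule someI_ex)
  then have "matrix_inv ?M *v (?M *v y) = y" by (simp add: matrix_vector_mul_assoc)
  then have "y = matrix_inv ?M *v x + matrix_inv ?M *v abelianization s"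
    unfolding ps(2) by (simp add: matrix_vector_right_distrib)
  then show ?thesis unfolding dual_face_def FG using ps(1) by auto
qed

lemma parent_face_id: "parent_face (\<lambda>x. x) F F"
  by (cases F) (auto simp: parent_face_def incidence_matrix_id intro: exI[of _ "[]"])

text \<open>An occurrence of \<open>k\<close> in \<open>\<tau> [j]\<close> and one of
  \<open>i\<close> in \<open>\<sigma> [k]\<close> combine to an occurrence of \<open>i\<close> with
  suffix \<open>s' @ \<sigma> s\<close>.\<close>

lemma parent_face_comp:
  assumes "word_morphism \<sigma>" "parent_face \<tau> F H" "parent_face \<sigma> H G"
  shows "parent_face (\<sigma> \<circ> \<tau>) F G"
proof -
  obtain y j z k x i where FHG: "F = (y, j)" "H = (z, k)" "G = (x, i)" by (metis surj_pair)
  obtain p s where ps: "\<tau> [j] = p @ [k] @ s" "incidence_matrix \<tau> *v y = z + abelianization s"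
    using assms(2) unfolding parent_face_def FHG by auto
  obtain p' s' where ps': "\<sigma> [k] = p' @ [i] @ s'" "incidence_matrix \<sigma> *v z = x + abelianization s'"
    using assms(3) unfolding parent_face_def FHG by auto
  have "(\<sigma> \<circ> \<tau>) [j] = (\<sigma> p @ p') @ [i] @ (s' @ \<sigma> s)"
    by (simp only: o_apply ps(1) ps'(1) word_morphism_append[OF assms(1)] append_assoc)
  moreover have "incidence_matrix (\<sigma> \<circ> \<tau>) *v y = incidence_matrix \<sigma> *v (incidence_matrix \<tau> *v y)"
    unfolding incidence_matrix_comp[OF assms(1)] by (simp add: matrix_vector_mul_assoc)
  then have "incidence_matrix (\<sigma> \<circ> \<tau>) *v y = x + abelianization (s' @ \<sigma> s)"
    unfolding ps(2) matrix_vector_right_distrib ps'(2) abelianization_append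
      abelianization_morphism[OF assms(1)] by simp
  ultimately show ?thesis unfolding parent_face_def FHG by blast
qed

lemma parent_face_arnoux_rauzy:
  "parent_face (arnoux_rauzy i) (y, j) (update i 0 y, i)"
  "j \<noteq> i \<Longrightarrow> parent_face (arnoux_rauzy i) (y, j) (update i 1 y, j)"
proof -
  have "arnoux_rauzy i [j] = (if j = i then [] else [j]) @ [i] @ []"
    by (simp add: arnoux_rauzy_letter)
  moreover have "incidence_matrix (arnoux_rauzy i) *v y = update i 0 y + abelianization []"
    by (simp add: arnoux_rauzy_mult)
  ultimately show "parent_face (arnoux_rauzy i) (y, j) (update i 0 y, i)"
    unfolding parent_face_def by blast
  assume "j \<noteq> i"
  then have "arnoux_rauzy i [j] = [] @ [j] @ [i]" by (simp add: arnoux_rauzy_letter)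
  moreover have "incidence_matrix (arnoux_rauzy i) *v y = update i 1 y + abelianization [i]"
    by (auto simp: arnoux_rauzy_mult abelianization_letter vec_eq_iff axis_def)
  ultimately show "parent_face (arnoux_rauzy i) (y, j) (update i 1 y, j)"
    unfolding parent_face_def by blast
qed

lemma dual_substitution_mono: "P \<subseteq> Q \<Longrightarrow> dual_substitution \<sigma> P \<subseteq> dual_substitution \<sigma> Q"
  by (auto simp: dual_substitution_def)

text \<open>Each application of the dual substitution leads from a parent back to its child, so
  \<open>n\<close> applications retrace a chain of \<open>n\<close> parents.\<close>

lemma dual_substitution_chain:
  assumes "invertible (incidence_matrix \<sigma> :: int ^ 3 ^ 3)"
    and "\<And>q. parent_face \<sigma> (f q) (f (Suc q))" and "f n \<in> P"
  shows "f 0 \<in> (dual_substitution \<sigma> ^^ n) P"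
  using assms(2,3)
proof (induction n arbitrary: f)
  case (Suc n)
  have "f (Suc 0) \<in> (dual_substitution \<sigma> ^^ n) P"
    using Suc.IH[of "\<lambda>q. f (Suc q)"] Suc.prems by simp
  moreover have "f 0 \<in> dual_substitution \<sigma> Q" if "f (Suc 0) \<in> Q" for Q
    using parent_face_dual_face[OF assms(1) Suc.prems(1)[of 0]] that
    by (auto simp: dual_substitution_def)
  ultimately show ?case by simp
qed simp

lemma (in fully_subtractive) parent_face_orbit:
  assumes "height (w 0) y < w 0 $ j"
  shows "parent_face (arnoux_rauzy (a n)) (orbit y n, orbit_type y j n)
    (orbit y (Suc n), orbit_type y j (Suc n))"
proof (cases "digit n (orbit y n) = 0")
  case True
  then show ?thesis by (simp add: step_def parent_face_arnoux_rauzy(1))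
next
  case False
  then have "digit n (orbit y n) = 1" "orbit_type y j n \<noteq> a n"
    using orbit_less_type[OF assms, of n] by (auto simp: digit_def split: if_splits)
  then show ?thesis by (simp add: step_def parent_face_arnoux_rauzy(2))
qed

lemma lower_faces_iff: "(y, j) \<in> lower_faces \<longleftrightarrow> y = 0"
  using exhaust_3[of j] by (auto simp: lower_faces_def)

section \<open>The periodic sequence given by a product and its eigenvector\<close>

locale arnoux_rauzy_eigenvector =
  fixes ks :: "3 list" and \<beta> :: real and v :: "real ^ 3"
  assumes letters: "set ks = UNIV"
    and v_pos: "\<And>i. v $ i > 0"
    and eigen: "fold transfer ks v = \<beta> *\<^sub>R v"
begin

abbreviation "\<sigma> \<equiv> arnoux_rauzy_product ks"

lemma \<beta>_pos: "\<beta> > 0"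
proof -
  have "0 < \<beta> * v $ 1" using fold_transfer_pos[OF v_pos, of ks 1] unfolding eigen by simp
  then show ?thesis using v_pos[of 1] by (simp add: zero_less_mult_iff)
qed

text \<open>The directive sequence reads \<open>ks\<close> backwards: the last substitution of the product is
  the first one whose dual has to be undone.\<close>

definition directive :: "nat \<Rightarrow> 3" where
  "directive n = ks ! (length ks - 1 - n mod length ks)"

text \<open>Within a block of \<open>length ks\<close> steps, the unread prefix of \<open>ks\<close>
  is still to be transferred. The extra factor \<open>1 / \<beta>\<close> cancels the
  \<open>\<beta>\<close> that the full fold produces at the start of a block.\<close>

definition normal_vector :: "nat \<Rightarrow> real ^ 3" where
  "normal_vector n = (1 / \<beta>) ^ Suc (n div length ks) *\<^sub>R fold transfer (take (length ks - n mod length ks) ks) v"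

lemma length_pos: "0 < length ks"
  using letters by (cases ks) auto

lemma le_mult_length: "n \<le> n * length ks"
  using length_pos by (cases "length ks") auto

lemma normal_vector_0: "normal_vector 0 = v"
  using \<beta>_pos by (simp add: normal_vector_def eigen)

lemma normal_vector_Suc: "normal_vector n = transfer (directive n) (normal_vector (Suc n))"
proof -
  define r where "r = n mod length ks"
  have r: "r < length ks" using length_pos by (simp add: r_def)
  show ?thesis
  proof (cases "Suc r = length ks")
    case False
    then have S: "Suc n mod length ks = Suc r" "Suc n div length ks = n div length ks"
      by (simp_all add: mod_Suc div_Suc r_def)
    have "length ks - r = Suc (length ks - Suc r)" using r by simp
    then have "take (length ks - r) ks = take (length ks - Suc r) ks @ [ks ! (length ks - Suc r)]"
      using r by (simp add: take_Suc_conv_app_nth)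
    then show ?thesis
      by (simp add: normal_vector_def directive_def S r_def[symmetric] transfer_scaleR)
  next
    case True
    then have S: "Suc n mod length ks = 0" "Suc n div length ks = Suc (n div length ks)"
      by (simp_all add: mod_Suc div_Suc r_def)
    have "take (length ks - r) ks = [ks ! (length ks - 1 - r)]"
      using True[symmetric] length_pos by (simp add: take_Suc_conv_app_nth)
    then show ?thesis using \<beta>_pos
      by (simp add: normal_vector_def directive_def S r_def[symmetric] transfer_scaleR eigen)
  qed
qed

sublocale fully_subtractive directive normal_vector
proof
  show "normal_vector n $ k > 0" for n k
    using \<beta>_pos fold_transfer_pos[OF v_pos] by (simp add: normal_vector_def)
  show "\<exists>m\<ge>n. directive m = k" for n k
  proof -
    obtain p where p: "p < length ks" "ks ! p = k" using letters by (metis UNIV_I in_set_conv_nth)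
    \<comment> \<open>The time in block \<open>n\<close> at which index \<open>p\<close> is read, as
      each block runs backwards.\<close>
    let ?m = "n * length ks + (length ks - 1 - p)"
    have le: "n \<le> ?m" using le_mult_length by (rule trans_le_add1)
    have "?m mod length ks = length ks - 1 - p" using p(1) by (subst mod_mult_self3) simp
    then have "directive ?m = k" using p by (simp add: directive_def)
    with le show ?thesis by blast
  qed
qed (rule normal_vector_Suc)

lemma parent_face_block:
  assumes "height v y < v $ j"
  defines "f \<equiv> \<lambda>n. (orbit y n, orbit_type y j n)"
  shows "parent_face \<sigma> (f (q * length ks)) (f (Suc q * length ks))"
proof -
  \<comment> \<open>The first \<open>r\<close> steps of a block undo the last \<open>r\<close>
    substitutions of the product.\<close>
  have "parent_face (arnoux_rauzy_product (drop (length ks - r) ks)) (f (q * length ks)) (f (q * length ks + r))"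
    if "r \<le> length ks" for r
    using that
  proof (induction r)
    case 0
    then show ?case by (simp add: parent_face_id)
  next
    case (Suc r)
    have i: "directive (q * length ks + r) = ks ! (length ks - Suc r)"
      using Suc.prems by (simp add: directive_def)
    have "drop (length ks - Suc r) ks = ks ! (length ks - Suc r) # drop (length ks - r) ks"
      using Suc.prems Cons_nth_drop_Suc[of "length ks - Suc r" ks] by (simp add: Suc_diff_Suc)
    then have prod: "arnoux_rauzy_product (drop (length ks - Suc r) ks)
        = arnoux_rauzy (ks ! (length ks - Suc r)) \<circ> arnoux_rauzy_product (drop (length ks - r) ks)"
      by (simp only: arnoux_rauzy_product_simps)
    have "parent_face (arnoux_rauzy (directive (q * length ks + r))) (f (q * length ks + r))
        (f (Suc (q * length ks + r)))"
      unfolding f_def by (rule parent_face_orbit) (simp add: normal_vector_0 assms(1))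
    then show ?case
      unfolding prod i add_Suc_right using Suc
      by (intro parent_face_comp[OF arnoux_rauzy_morphism]) simp_all
  qed
  from this[of "length ks"] show ?thesis by (simp add: add.commute)
qed

text \<open>The orbit of 0 is constant, so every face at the origin has a parent there. Hence the
  iterates increase and one \<open>n\<close> serves finitely many faces.\<close>

lemma lower_faces_increasing: "lower_faces \<subseteq> dual_substitution \<sigma> lower_faces"
proof
  fix F :: face assume F: "F \<in> lower_faces"
  obtain y j where "F = (y, j)" by (metis surj_pair)
  with F have F0: "F = (0, j)" by (simp add: lower_faces_iff)
  have "parent_face \<sigma> F (orbit 0 (length ks), orbit_type 0 j (length ks))"
    using parent_face_block[of 0 j 0] v_pos by (simp add: F0)
  then have "F \<in> dual_face \<sigma> (orbit 0 (length ks), orbit_type 0 j (length ks))"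
    by (rule parent_face_dual_face[OF invertible_arnoux_rauzy_product])
  moreover have "(orbit 0 (length ks), orbit_type 0 j (length ks)) \<in> lower_faces"
    using orbit_zero[of 0 0] by (simp add: lower_faces_iff)
  ultimately show "F \<in> dual_substitution \<sigma> lower_faces" by (auto simp: dual_substitution_def)
qed

lemma iterates_increasing:
  assumes "m \<le> n"
  shows "(dual_substitution \<sigma> ^^ m) lower_faces \<subseteq> (dual_substitution \<sigma> ^^ n) lower_faces"
proof -
  have "(dual_substitution \<sigma> ^^ m) lower_faces \<subseteq> (dual_substitution \<sigma> ^^ Suc m) lower_faces" for m
    by (induction m) (use lower_faces_increasing dual_substitution_mono in auto)
  then show ?thesis using assms by (rule lift_Suc_mono_le)
qed

theorem face_in_iterate:
  assumes "0 \<le> height v y" "height v y < v $ j"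
  shows "\<exists>n. (y, j) \<in> (dual_substitution \<sigma> ^^ n) lower_faces"
proof -
  obtain n where "orbit y n = 0" using orbit_vanishes[of y j] assms by (auto simp: normal_vector_0)
  \<comment> \<open>Block ends are where the whole product applies; since 0 persists,
    \<open>n\<close> may be replaced by a multiple of the block length.\<close>
  then have "orbit y (n * length ks) = 0" using le_mult_length by (rule orbit_zero)
  then have "(orbit y (n * length ks), orbit_type y j (n * length ks)) \<in> lower_faces"
    by (simp add: lower_faces_iff)
  then have "(orbit y (0 * length ks), orbit_type y j (0 * length ks)) \<in> (dual_substitution \<sigma> ^^ n) lower_faces"
    using parent_face_block[OF assms(2)]
    by (intro dual_substitution_chain[OF invertible_arnoux_rauzy_product,
          of ks "\<lambda>q. (orbit y (q * length ks), orbit_type y j (q * length ks))"])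
  then show ?thesis by auto
qed

lemma finite_subset_iterate:
  assumes "finite P" "\<And>y j. (y, j) \<in> P \<Longrightarrow> 0 \<le> height v y \<and> height v y < v $ j"
  shows "\<exists>n. P \<subseteq> (dual_substitution \<sigma> ^^ n) lower_faces"
  using assms
proof (induction P rule: finite_induct)
  case (insert F P)
  obtain m where m: "P \<subseteq> (dual_substitution \<sigma> ^^ m) lower_faces" using insert by auto
  obtain n where n: "F \<in> (dual_substitution \<sigma> ^^ n) lower_faces"
    using face_in_iterate[of "fst F" "snd F"] insert.prems[of "fst F" "snd F"] by auto
  have "insert F P \<subseteq> (dual_substitution \<sigma> ^^ max m n) lower_faces"
    using m n iterates_increasing[of m "max m n"] iterates_increasing[of n "max m n"] by auto
  then show ?case ..
qed auto

end

section \<open>Lifting points of the contracting plane\<close>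

lemma exists_small_scalar:
  fixes u c :: "'n::finite \<Rightarrow> real"
  assumes "\<And>k. u k > 0" "\<And>k. c k > 0"
  shows "\<exists>e>0. \<forall>k. e * u k < c k"
proof -
  define e where "e = Min (range (\<lambda>k. c k / (2 * u k)))"
  have "e > 0" unfolding e_def using assms by (subst Min_gr_iff) auto
  moreover have "e * u k < c k" for k
  proof -
    have "e \<le> c k / (2 * u k)" unfolding e_def by (intro Min_le) auto
    then have "e * u k \<le> c k / 2" using assms(1)[of k] by (simp add: field_simps)
    then show ?thesis using assms(2)[of k] by linarith
  qed
  ultimately show ?thesis by blast
qed

lemma exists_bound:
  fixes f :: "'n::finite \<Rightarrow> 'a::linorder"
  shows "\<exists>b. \<forall>k. f k \<le> b" and "\<exists>b. \<forall>k. b \<le> f k"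
  by (rule exI[of _ "Max (range f)"], simp) (rule exI[of _ "Min (range f)"], simp)

lemma in_unit_face:
  assumes "q $ i = of_int (z $ i)" "\<And>k. of_int (z $ k) \<le> q $ k" "\<And>k. q $ k \<le> of_int (z $ k) + 1"
  shows "q \<in> unit_face (z, i)"
proof -
  obtain j k where ijk: "i \<noteq> j" "i \<noteq> k" "j \<noteq> k" "UNIV = {i, j, k}" by (rule three_letters)
  have "q = (\<chi> r. real_of_int (z $ r)) + (q $ j - of_int (z $ j)) *\<^sub>R axis j 1
      + (q $ k - of_int (z $ k)) *\<^sub>R axis k 1"
    unfolding vec_eq_iff all_letters_iff[OF ijk(4)] using ijk(1-3) assms(1)
    by (simp add: axis_def)
  moreover have "q $ j - of_int (z $ j) \<in> {0..1}" "q $ k - of_int (z $ k) \<in> {0..1}"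
    using assms(2,3)[of j] assms(2,3)[of k] by auto
  ultimately show ?thesis unfolding unit_face_def using ijk(4) by fastforce
qed

lemma unit_face_bounds:
  assumes "q \<in> unit_face (z, i)"
  shows "of_int (z $ k) \<le> q $ k" "q $ k \<le> of_int (z $ k) + 1"
proof -
  obtain a b j l where q: "q = (\<chi> r. real_of_int (z $ r)) + a *\<^sub>R axis j 1 + b *\<^sub>R axis l 1"
    "0 \<le> a" "a \<le> 1" "0 \<le> b" "b \<le> 1" "{i, j, l} = UNIV"
    using assms by (auto simp: unit_face_def)
  \<comment> \<open>A repeated direction would let one coordinate grow by 2.\<close>
  have "j \<noteq> l"
  proof
    assume "j = l"
    obtain k' l' where kl: "i \<noteq> k'" "i \<noteq> l'" "k' \<noteq> l'" by (rule three_letters)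
    have "k' \<in> {i, j, l}" "l' \<in> {i, j, l}" unfolding q(6) by simp_all
    then show False using kl \<open>j = l\<close> by auto
  qed
  then show "of_int (z $ k) \<le> q $ k" "q $ k \<le> of_int (z $ k) + 1"
    using q(2-5) by (auto simp: q(1) axis_def)
qed

text \<open>Moving from \<open>x\<close> to \<open>y\<close> one coordinate at a time, the height changes sign in some
  coordinate \<open>i\<close>.\<close>

lemma sign_change:
  assumes "0 \<le> height v x" "height v y < 0" "\<And>k. y $ k \<le> x $ k" "\<And>k. x $ k \<le> y $ k + 1"
  obtains z i where "0 \<le> height v z" "height v z < v $ i" "z $ i = x $ i" "x $ i = y $ i + 1"
    "\<forall>k. z $ k = x $ k \<or> z $ k = y $ k"
proof -
  note result = that
  define g where "g S = (\<chi> k. if k \<in> S then y $ k else x $ k)" for S :: "3 set"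
  have drop: thesis if "i \<notin> S" "0 \<le> height v (g S)" "height v (g (insert i S)) < 0" for i S
  proof -
    have "x $ i = y $ i \<or> x $ i = y $ i + 1" using assms(3,4)[of i] by linarith
    moreover have "g (insert i S) = g S" if "x $ i = y $ i"
      using that by (auto simp: g_def vec_eq_iff)
    ultimately have xi: "x $ i = y $ i + 1" using that by auto
    then have "g (insert i S) = g S - axis i 1"
      using \<open>i \<notin> S\<close> by (auto simp: g_def vec_eq_iff axis_def)
    then have "height v (g S) < v $ i" using that(3) by (simp add: height_diff)
    then show thesis using that xi by (intro result[of "g S" i]) (auto simp: g_def)
  qed
  have "g {} = x" "g (insert 3 (insert 2 (insert 1 {}))) = y"
    using UNIV_3 by (auto simp: g_def vec_eq_iff forall_3)
  then have "0 \<le> height v (g {})" "height v (g (insert 3 (insert 2 (insert 1 {})))) < 0"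
    using assms(1,2) by auto
  then show thesis
    using drop[of 1 "{}"] drop[of 2 "insert 1 {}"] drop[of 3 "insert 2 (insert 1 {})"]
    by (cases "0 \<le> height v (g {1})"; cases "0 \<le> height v (g {2, 1})") auto
qed

text \<open>The parameter \<open>s\<close> is the one at which the line enters the union of the unit cubes
  whose lower corner has nonnegative height.\<close>

lemma line_meets_face:
  fixes u v p :: "real ^ 3"
  assumes u: "\<And>k. u $ k > 0" and v: "\<And>k. v $ k > 0"
  obtains s z i where "0 \<le> height v z" "height v z < v $ i" "p + s *\<^sub>R u \<in> unit_face (z, i)"
proof -
  define fl :: "real ^ 3 \<Rightarrow> int ^ 3" where "fl q = (\<chi> k. \<lfloor>q $ k\<rfloor>)" for q
  define G where "G = {s. 0 \<le> height v (fl (p + s *\<^sub>R u))}"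
  \<comment> \<open>From \<open>b\<close> on all coordinates are nonnegative and before
    \<open>c\<close> all are negative, so \<open>G\<close> is nonempty and bounded below.\<close>
  obtain b where b: "\<And>k. - p $ k / u $ k \<le> b" using exists_bound(1)[of "\<lambda>k. - p $ k / u $ k"] by blast
  have "0 \<le> p $ k + b * u $ k" for k using b[of k] u[of k] by (simp add: field_simps)
  then have "height v 0 \<le> height v (fl (p + b *\<^sub>R u))"
    by (intro height_mono v) (simp add: fl_def)
  then have "b \<in> G" by (simp add: G_def)
  obtain c where c: "\<And>k. c \<le> - p $ k / u $ k" using exists_bound(2)[of "\<lambda>k. - p $ k / u $ k"] by blast
  have lower: "c \<le> s" if "s \<in> G" for s
  proof (rule ccontr)
    assume "\<not> c \<le> s"
    have "fl (p + s *\<^sub>R u) $ k \<le> (- 1) $ k" for k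
    proof -
      have "s < - p $ k / u $ k" using \<open>\<not> c \<le> s\<close> c[of k] by linarith
      then have "s * u $ k < - p $ k" using u[of k] by (simp only: pos_less_divide_eq)
      then have "\<lfloor>(p + s *\<^sub>R u) $ k\<rfloor> < 0" by simp
      then have "\<lfloor>(p + s *\<^sub>R u) $ k\<rfloor> \<le> - 1" by linarith
      then show ?thesis by (simp add: fl_def)
    qed
    then have "height v (fl (p + s *\<^sub>R u)) \<le> - height v 1"
      using height_mono[OF v, of "fl (p + s *\<^sub>R u)" "- 1"] by (simp add: height_uminus)
    moreover have "0 < height v 1"
      unfolding height_def using v by (intro sum_pos) auto
    ultimately show False using that by (simp add: G_def)
  qed
  define t where "t = Inf G"
  define q where "q = p + t *\<^sub>R u"
  \<comment> \<open>Since \<open>u\<close> is positive, this is the floor vector just before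
    \<open>t\<close> on the line, while \<open>fl q\<close> is the one at \<open>t\<close> and just
    after it.\<close>
  define ce :: "int ^ 3" where "ce = (\<chi> k. \<lceil>q $ k\<rceil> - 1)"
  have x: "0 \<le> height v (fl q)"
  proof (rule ccontr)
    assume neg: "\<not> ?thesis"
    have gap: "0 < of_int \<lfloor>q $ k\<rfloor> + 1 - q $ k" for k by linarith
    have "\<exists>e>0. \<forall>k. e * u $ k < of_int \<lfloor>q $ k\<rfloor> + 1 - q $ k"
      by (rule exists_small_scalar[OF u gap])
    then obtain e where e: "e > 0" "\<And>k. e * u $ k < of_int \<lfloor>q $ k\<rfloor> + 1 - q $ k" by auto
    have "t + e \<le> s" if "s \<in> G" for s
    proof (rule ccontr)
      assume "\<not> ?thesis"
      have "fl (p + s *\<^sub>R u) $ k \<le> fl q $ k" for k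
      proof -
        have "s * u $ k \<le> (t + e) * u $ k"
          using u[of k] \<open>\<not> t + e \<le> s\<close> by (intro mult_right_mono) auto
        moreover have "q $ k = p $ k + t * u $ k" by (simp add: q_def)
        ultimately have "p $ k + s * u $ k < of_int (\<lfloor>q $ k\<rfloor> + 1)"
          using e(2)[of k] distrib_right[of t e "u $ k"] unfolding of_int_add of_int_1 by linarith
        then have "\<lfloor>p $ k + s * u $ k\<rfloor> < \<lfloor>q $ k\<rfloor> + 1" by (simp only: floor_less_iff)
        then show ?thesis by (simp add: fl_def)
      qed
      then have "height v (fl (p + s *\<^sub>R u)) \<le> height v (fl q)" by (intro height_mono v)
      then show False using neg that by (simp add: G_def)
    qed
    then have "t + e \<le> Inf G" using \<open>b \<in> G\<close> by (intro cInf_greatest) auto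
    then show False using e(1) by (simp add: t_def)
  qed
  have y: "height v ce < 0"
  proof (rule ccontr)
    assume nonneg: "\<not> ?thesis"
    have gap: "0 < q $ k - (of_int \<lceil>q $ k\<rceil> - 1)" for k by linarith
    have "\<exists>e>0. \<forall>k. e * u $ k < q $ k - (of_int \<lceil>q $ k\<rceil> - 1)"
      by (rule exists_small_scalar[OF u gap])
    then obtain e where e: "e > 0" "\<And>k. e * u $ k < q $ k - (of_int \<lceil>q $ k\<rceil> - 1)" by auto
    have "ce $ k \<le> fl (p + (t - e) *\<^sub>R u) $ k" for k
    proof -
      have "q $ k = p $ k + t * u $ k" by (simp add: q_def)
      then have "of_int (\<lceil>q $ k\<rceil> - 1) \<le> p $ k + (t - e) * u $ k"
        using e(2)[of k] left_diff_distrib[of t e "u $ k"] unfolding of_int_diff of_int_1 by linarith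
      then have "\<lceil>q $ k\<rceil> - 1 \<le> \<lfloor>p $ k + (t - e) * u $ k\<rfloor>" by (simp only: le_floor_iff)
      then show ?thesis by (simp add: fl_def ce_def)
    qed
    then have "height v ce \<le> height v (fl (p + (t - e) *\<^sub>R u))" by (intro height_mono v)
    then have "t - e \<in> G" using nonneg by (simp add: G_def)
    then have "Inf G \<le> t - e" using lower by (intro cInf_lower) (auto intro: bdd_belowI[of _ c])
    then show False using e(1) by (simp add: t_def)
  qed
  have fc: "ce $ k \<le> fl q $ k" "fl q $ k \<le> ce $ k + 1" for k
    unfolding fl_def ce_def vec_lambda_beta by linarith+
  obtain z i where zi: "0 \<le> height v z" "height v z < v $ i" "z $ i = fl q $ i" "fl q $ i = ce $ i + 1"
    "\<forall>k. z $ k = fl q $ k \<or> z $ k = ce $ k"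
    by (rule sign_change[OF x y fc])
  have "q \<in> unit_face (z, i)"
  proof (rule in_unit_face)
    show "q $ i = of_int (z $ i)" using zi(3,4) unfolding fl_def ce_def vec_lambda_beta by linarith
    show "of_int (z $ k) \<le> q $ k" "q $ k \<le> of_int (z $ k) + 1" for k
      using zi(5)[rule_format, of k] unfolding fl_def ce_def vec_lambda_beta by linarith+
  qed
  then show thesis using that zi(1,2) by (simp add: q_def)
qed

lemma finite_int_box: "finite {z :: int ^ 'n. \<forall>k. z $ k \<in> {lo..hi}}"
proof (rule finite_subset)
  show "{z :: int ^ 'n. \<forall>k. z $ k \<in> {lo..hi}} \<subseteq> vec_lambda ` (UNIV \<rightarrow>\<^sub>E {lo..hi})"
    by (auto intro!: image_eqI[of _ _ "vec_nth _"])
qed (intro finite_imageI finite_PiE; simp)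

text \<open>If the lift \<open>p + s *\<^sub>R u\<close> lies on \<open>(z, i)\<close>, its inner
  product with \<open>v\<close> is between \<open>height v z\<close> and
  \<open>height v z + V\<close>, hence between 0 and \<open>2 * V\<close>. This bounds
  \<open>s\<close> by \<open>B\<close>, and then \<open>z\<close>.\<close>

lemma finite_faces_over_ball:
  fixes u v :: "real ^ 3"
  assumes u: "\<And>k. u $ k > 0" and v: "\<And>k. v $ k > 0"
  obtains P where "finite P" "\<And>z i. (z, i) \<in> P \<Longrightarrow> 0 \<le> height v z \<and> height v z < v $ i"
    "\<And>p. p \<in> cball 0 R \<inter> plane_normal v \<Longrightarrow> \<exists>s. p + s *\<^sub>R u \<in> realization P"
proof -
  have vu: "0 < v \<bullet> u" unfolding inner_vec_def using u v by (intro sum_pos) auto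
  define V where "V = (\<Sum>k\<in>UNIV. v $ k)"
  have V: "v $ i \<le> V" for i
    unfolding V_def using v by (intro member_le_sum) (auto intro: less_imp_le)
  define B where "B = 2 * V / (v \<bullet> u)"
  obtain U where U: "\<And>k. u $ k \<le> U" using exists_bound(1)[of "($) u"] by blast
  have "0 < U" using u[of 1] U[of 1] by linarith
  have "0 \<le> V" using v[of 1] V[of 1] by linarith
  then have "0 \<le> B" using vu by (simp add: B_def)
  \<comment> \<open>The summand 1 is the width of a unit face in a coordinate.\<close>
  define K where "K = \<lceil>\<bar>R\<bar> + B * U + 1\<rceil>"
  define P :: "face set" where
    "P = {(z, i). 0 \<le> height v z \<and> height v z < v $ i \<and> (\<forall>k. z $ k \<in> {-K..K})}"
  have "finite P"
  proof (rule finite_subset)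
    show "P \<subseteq> {z. \<forall>k. z $ k \<in> {-K..K}} \<times> UNIV" by (auto simp: P_def)
  qed (intro finite_cartesian_product finite_int_box finite)
  moreover have "\<exists>s. p + s *\<^sub>R u \<in> realization P" if p: "p \<in> cball 0 R \<inter> plane_normal v" for p
  proof -
    obtain s z i where szi: "0 \<le> height v z" "height v z < v $ i" "p + s *\<^sub>R u \<in> unit_face (z, i)"
      by (rule line_meets_face[OF u v])
    note bd = unit_face_bounds[OF szi(3)]
    have vq: "v \<bullet> (p + s *\<^sub>R u) = s * (v \<bullet> u)"
      using p by (simp add: plane_normal_def inner_add_right)
    have "height v z \<le> v \<bullet> (p + s *\<^sub>R u)"
      unfolding height_def inner_vec_def using v bd
      by (auto intro!: sum_mono mult_left_mono simp: less_imp_le)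
    then have "0 \<le> s * (v \<bullet> u)" using szi(1) vq by linarith
    then have s0: "0 \<le> s" using vu by (simp add: zero_le_mult_iff)
    have "v \<bullet> (p + s *\<^sub>R u) \<le> (\<Sum>k\<in>UNIV. v $ k * (of_int (z $ k) + 1))"
      unfolding inner_vec_def inner_real_def using v bd
      by (intro sum_mono mult_left_mono) (auto simp: less_imp_le)
    also have "\<dots> = height v z + V" by (simp add: height_def V_def algebra_simps sum.distrib)
    finally have "s * (v \<bullet> u) \<le> 2 * V" using szi(2) V[of i] vq by linarith
    then have "s \<le> B" using vu by (simp add: B_def field_simps)
    have "z $ k \<in> {-K..K}" for k
    proof -
      have "\<bar>p $ k\<bar> \<le> \<bar>R\<bar>" using p component_le_norm_cart[of p k] by auto
      moreover have "0 \<le> s * u $ k" "s * u $ k \<le> B * U"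
        using s0 u[of k] U[of k] \<open>s \<le> B\<close> \<open>0 \<le> B\<close> by (auto intro!: mult_mono)
      ultimately have "of_int (z $ k) \<le> \<bar>R\<bar> + B * U + 1" "- (\<bar>R\<bar> + B * U + 1) \<le> of_int (z $ k)"
        using bd[of k] by auto
      then show ?thesis unfolding K_def atLeastAtMost_iff by linarith
    qed
    then have "(z, i) \<in> P" using szi by (simp add: P_def)
    then show ?thesis using szi(3) by (auto simp: realization_def)
  qed
  ultimately show thesis by (intro that[of P]) (auto simp: P_def)
qed

theorem theorem4p4:
  fixes ks :: "3 list" and \<sigma> :: "word3 \<Rightarrow> word3" and \<beta> :: real and u v :: "real ^ 3" and R :: real
  assumes "set ks = {1, 2, 3}"
    and "\<sigma> = arnoux_rauzy_product ks"
    and "maximal_eigenvalue \<sigma> \<beta>"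
    and "\<And>i. u $ i > 0" and "incidence_matrix \<sigma> *v u = \<beta> *\<^sub>R u"
    and "\<And>i. v $ i > 0" and "transpose (incidence_matrix \<sigma>) *v v = \<beta> *\<^sub>R v"
    and "R \<ge> 0"
  shows "\<exists>n::nat. cball 0 R \<inter> plane_normal v
           \<subseteq> proj_along u v ` realization ((dual_substitution \<sigma> ^^ n) lower_faces)"
proof -
  interpret arnoux_rauzy_eigenvector ks \<beta> v
    rewrites "arnoux_rauzy_product ks = \<sigma>"
  proof -
    show "arnoux_rauzy_eigenvector ks \<beta> v"
    proof
      show "set ks = UNIV" using assms(1) by (simp only: UNIV_3)
      show "fold transfer ks v = \<beta> *\<^sub>R v"
        using assms(7) unfolding assms(2) transpose_arnoux_rauzy_product_mult .
    qed (rule assms(6))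
  qed (simp only: assms(2))
  obtain P where P: "finite P" "\<And>z i. (z, i) \<in> P \<Longrightarrow> 0 \<le> height v z \<and> height v z < v $ i"
    "\<And>p. p \<in> cball 0 R \<inter> plane_normal v \<Longrightarrow> \<exists>s. p + s *\<^sub>R u \<in> realization P"
    using finite_faces_over_ball[of u v, OF assms(4,6)] by blast
  obtain n where n: "P \<subseteq> (dual_substitution \<sigma> ^^ n) lower_faces"
    using finite_subset_iterate[OF P(1,2)] by blast
  have vu: "v \<bullet> u \<noteq> 0"
    using assms(4,6) unfolding inner_vec_def by (intro less_imp_neq[THEN not_sym] sum_pos) auto
  have "p \<in> proj_along u v ` realization ((dual_substitution \<sigma> ^^ n) lower_faces)"
    if p: "p \<in> cball 0 R \<inter> plane_normal v" for p
  proof -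
    obtain s where "p + s *\<^sub>R u \<in> realization P" using P(3)[OF p] by blast
    then have "p + s *\<^sub>R u \<in> realization ((dual_substitution \<sigma> ^^ n) lower_faces)"
      using n by (auto simp: realization_def)
    moreover have "p = proj_along u v (p + s *\<^sub>R u)"
      using p vu by (simp add: proj_along_def plane_normal_def inner_add_right)
    ultimately show ?thesis by blast
  qed
  then show ?thesis by blast
qed

end
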